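(* Let $\alpha$ be a set with an involution $\tau:\alpha\to\alpha$. If $\tau\neq\mathrm{id}$, then the group $\mathcal N_c=\mathcal N_c(\alpha,\tau)$ of cobordism classes of nanowords over $\alpha$ is infinitely generated (i.e. not finitely generated).
   Context: **Nanowords.** $\alpha$ is a set with an involution $\tau:\alpha\to\alpha$ ($\tau^2=\mathrm{id}$; fixed points allowed). An $\alpha$-alphabet is a set $\mathcal A$ with a map $\mathcal A\to\alpha$, $A\mapsto|A|$. A nanoword of length $n$ over $\alpha$ is a pair $(\mathcal A,w)$ with $\mathcal A$ an $\alpha$-alphabet and $w:\{1,\dots,n\}\to\mathcal A$ a map (written as the sequence $w(1)\cdots w(n)$) taking every value in $\mathcal A$ exactly twice; there is a unique empty nanoword $\emptyset$. Nanowords $(\mathcal A,w),(\mathcal A',w')$ are isomorphic if $w'=fw$ for a bijection $f:\mathcal A\to\mathcal A'$ with $|f(A)|=|A|$. The opposite word of $w$ is $w^-=w(n)\cdots w(1)$. The product of two nanowords is their concatenation, after making the alphabets disjoint by an isomorphism. **Homotopy moves.** (1) $(\mathcal A,xAAy)\mapsto(\mathcal A-\{A\},xy)$; (2) $(\mathcal A,xAByBAz)\mapsto(\mathcal A-\{A,B\},xyz)$ if $|B|=\tau(|A|)$; (3) $(\mathcal A,xAByACzBCt)\mapsto(\mathcal A,xBAyCAzCBt)$ for distinct $A,B,C$ with $|A|=|B|=|C|$. **Surgery.** A nanophrase $\nabla=(\mathcal B,(v_1|\cdots|v_k))$ is a sequence of words in an $\alpha$-alphabet $\mathcal B$ such that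 every letter of $\mathcal B$ appears exactly twice in $v_1v_2\cdots v_k$. Put $\varepsilon_\nabla(B)=0$ if both occurrences of $B$ are in the same $v_r$, and $\varepsilon_\nabla(B)=1$ otherwise. $\nabla$ is even if all $v_r$ have even length; it is symmetric if there is a bijection $\iota:\mathcal B\to\mathcal B$ with $\iota v_r=v_r^-$ for all $r$ and $|\iota(B)|=\tau^{\varepsilon_\nabla(B)}(|B|)$ for all $B$. $\nabla$ is a factor of a nanoword $(\mathcal A,w)$ if $\mathcal B\subset\mathcal A$ (with restricted projection to $\alpha$) and $w=x_1v_1x_2v_2\cdots x_kv_kx_{k+1}$ with $x_i$ words in $\mathcal A-\mathcal B$. A surgery replaces $(\mathcal A,w)$ by $(\mathcal A-\mathcal B,x_1x_2\cdots x_{k+1})$, where $\nabla$ is an even symmetric factor. **Cobordism.** Two nanowords are cobordant if they are related by a finite sequence of isomorphisms, homotopy moves, surgeries and inverse moves. The cobordism classes form a group $\mathcal N_c=\mathcal N_c(\alpha,\tau)$ under concatenation, with unit the class of $\emptyset$ and inverse of $w$ given by $w^-$. *)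

theory Defs
  imports "HOL-Algebra.Generated_Groups"
begin

section \<open>Nanowords\<close>

text \<open>
  An alphabet over \<open>'a\<close> is a set of natural numbers with a projection to \<open>'a\<close>; only the values of
  the projection on the alphabet matter. The alphabet of a nanoword is finite, so every nanoword is
  isomorphic to one of this kind.
\<close>

type_synonym 'a nanoword = "nat set \<times> (nat \<Rightarrow> 'a) \<times> nat list"

definition is_nanoword :: "'a nanoword \<Rightarrow> bool" where
  "is_nanoword = (\<lambda>(A, p, w). set w \<subseteq> A \<and> (\<forall>a\<in>A. count_list w a = 2))"

definition empty_nanoword :: "'a nanoword" where
  "empty_nanoword = ({}, \<lambda>_. undefined, [])"

definition isomorphic :: "'a nanoword \<Rightarrow> 'a nanoword \<Rightarrow> bool" where
  "isomorphic = (\<lambda>(A, p, w) (A', p', w').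
     \<exists>f. bij_betw f A A' \<and> (\<forall>a\<in>A. p' (f a) = p a) \<and> w' = map f w)"

definition opposite :: "'a nanoword \<Rightarrow> 'a nanoword" where
  "opposite = (\<lambda>(A, p, w). (A, p, rev w))"

text \<open>The letters of the two factors are made disjoint by renaming them to even and odd numbers.\<close>

definition nanoword_prod :: "'a nanoword \<Rightarrow> 'a nanoword \<Rightarrow> 'a nanoword" where
  "nanoword_prod = (\<lambda>(A, p, v) (B, q, w).
     ((\<lambda>n. 2 * n) ` A \<union> (\<lambda>n. 2 * n + 1) ` B,
      (\<lambda>n. if even n then p (n div 2) else q (n div 2)),
      map (\<lambda>n. 2 * n) v @ map (\<lambda>n. 2 * n + 1) w))"

section \<open>Homotopy moves and surgeries\<close>

text \<open>The moves are only applied to nanowords; in the second one this forces \<open>a \<noteq> b\<close>.\<close>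

inductive homotopy_move :: "('a \<Rightarrow> 'a) \<Rightarrow> 'a nanoword \<Rightarrow> 'a nanoword \<Rightarrow> bool"
  for \<tau> :: "'a \<Rightarrow> 'a" where
  move1: "homotopy_move \<tau> (A, p, x @ [a, a] @ y) (A - {a}, p, x @ y)"
| move2: "p b = \<tau> (p a) \<Longrightarrow>
    homotopy_move \<tau> (A, p, x @ [a, b] @ y @ [b, a] @ z) (A - {a, b}, p, x @ y @ z)"
| move3: "distinct [a, b, c] \<Longrightarrow> p a = p b \<Longrightarrow> p b = p c \<Longrightarrow>
    homotopy_move \<tau> (A, p, x @ [a, b] @ y @ [a, c] @ z @ [b, c] @ t)
                    (A, p, x @ [b, a] @ y @ [c, a] @ z @ [c, b] @ t)"

type_synonym 'a nanophrase = "nat set \<times> (nat \<Rightarrow> 'a) \<times> nat list list"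

definition is_nanophrase :: "'a nanophrase \<Rightarrow> bool" where
  "is_nanophrase = (\<lambda>(B, p, vs).
     set (concat vs) \<subseteq> B \<and> (\<forall>b\<in>B. count_list (concat vs) b = 2))"

definition phrase_eps :: "'a nanophrase \<Rightarrow> nat \<Rightarrow> nat" where
  "phrase_eps = (\<lambda>(B, p, vs) b. if \<exists>v\<in>set vs. count_list v b = 2 then 0 else 1)"

definition even_phrase :: "'a nanophrase \<Rightarrow> bool" where
  "even_phrase = (\<lambda>(B, p, vs). \<forall>v\<in>set vs. even (length v))"

definition symmetric_phrase :: "('a \<Rightarrow> 'a) \<Rightarrow> 'a nanophrase \<Rightarrow> bool" where
  "symmetric_phrase \<tau> = (\<lambda>(B, p, vs). \<exists>\<iota>. bij_betw \<iota> B B \<and>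
     (\<forall>v\<in>set vs. map \<iota> v = rev v) \<and>
     (\<forall>b\<in>B. p (\<iota> b) = (\<tau> ^^ phrase_eps (B, p, vs) b) (p b)))"

text \<open>Below, \<open>xs = [x\<^sub>1, \<dots>, x\<^sub>k]\<close>, \<open>vs = [v\<^sub>1, \<dots>, v\<^sub>k]\<close> and \<open>y = x\<^sub>k\<^sub>+\<^sub>1\<close>.\<close>

inductive surgery :: "('a \<Rightarrow> 'a) \<Rightarrow> 'a nanoword \<Rightarrow> 'a nanoword \<Rightarrow> bool"
  for \<tau> :: "'a \<Rightarrow> 'a" where
  "is_nanophrase (B, p, vs) \<Longrightarrow> even_phrase (B, p, vs) \<Longrightarrow> symmetric_phrase \<tau> (B, p, vs) \<Longrightarrow>
   B \<subseteq> A \<Longrightarrow> length xs = length vs \<Longrightarrow> set (concat xs) \<subseteq> A - B \<Longrightarrow> set y \<subseteq> A - B \<Longrightarrow>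
   surgery \<tau> (A, p, concat (map2 (@) xs vs) @ y) (A - B, p, concat xs @ y)"

section \<open>Cobordism\<close>

definition cobordism_step :: "('a \<Rightarrow> 'a) \<Rightarrow> 'a nanoword \<Rightarrow> 'a nanoword \<Rightarrow> bool" where
  "cobordism_step \<tau> u v \<longleftrightarrow> is_nanoword u \<and> is_nanoword v \<and>
     (isomorphic u v \<or> homotopy_move \<tau> u v \<or> surgery \<tau> u v)"

definition cobordism_rel :: "('a \<Rightarrow> 'a) \<Rightarrow> ('a nanoword \<times> 'a nanoword) set" where
  "cobordism_rel \<tau> =
     {(u, v). is_nanoword u \<and> is_nanoword v \<and> equivclp (cobordism_step \<tau>) u v}"

text \<open>
  The union in the multiplication is over representatives; by \<open>cobordism_group_mult\<close> below it is the
  class of the product of any two of them.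
\<close>

definition cobordism_group :: "('a \<Rightarrow> 'a) \<Rightarrow> 'a nanoword set monoid" where
  "cobordism_group \<tau> =
     \<lparr>carrier = {u. is_nanoword u} // cobordism_rel \<tau>,
      mult = (\<lambda>X Y. \<Union>u\<in>X. \<Union>v\<in>Y. cobordism_rel \<tau> `` {nanoword_prod u v}),
      one = cobordism_rel \<tau> `` {empty_nanoword}\<rparr>"

section \<open>Cobordism classes form a group\<close>

lemma count_list_map_inj: "inj f \<Longrightarrow> count_list (map f w) (f a) = count_list w a"
  by (induction w) (simp_all add: inj_eq)

lemma nanoword_prod_nanoword:
  assumes "is_nanoword u" "is_nanoword v"
  shows "is_nanoword (nanoword_prod u v)"
proof -
  obtain A p w B q z where uv: "u = (A, p, w)" "v = (B, q, z)" by (metis prod_cases3)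
  have inj: "inj (\<lambda>n::nat. 2 * n)" "inj (\<lambda>n::nat. 2 * n + 1)" by (auto simp: inj_def)
  have 0: "count_list (map (\<lambda>n::nat. 2 * n + 1) l) (2 * a) = 0"
    "count_list (map (\<lambda>n::nat. 2 * n) l) (2 * a + 1) = 0" for l a
    by (auto simp: count_list_0_iff double_not_eq_Suc_double Suc_double_not_eq_double)
  show ?thesis
    using assms 0 count_list_map_inj[OF inj(1)] count_list_map_inj[OF inj(2)]
    by (auto simp: uv is_nanoword_def nanoword_prod_def)
qed

lemma empty_nanoword_nanoword: "is_nanoword empty_nanoword"
  by (simp add: is_nanoword_def empty_nanoword_def)

lemma opposite_nanoword: "is_nanoword u \<Longrightarrow> is_nanoword (opposite u)"
  by (auto simp: is_nanoword_def opposite_def)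

lemma isomorphicI:
  assumes "inj_on f A" "\<And>a. a \<in> A \<Longrightarrow> p' (f a) = p a" "A' = f ` A" "w' = map f w"
  shows "isomorphic (A, p, w) (A', p', w')"
  unfolding isomorphic_def prod.case bij_betw_def by (rule exI[of _ f]) (simp add: assms)

lemma homotopy_move_embed:
  assumes "homotopy_move \<tau> (A, p, w) (A', p', w')" "is_nanoword (A, p, w)" "inj f"
    and q: "\<And>a. a \<in> A \<Longrightarrow> q (f a) = p a" and C: "C \<inter> f ` A = {}"
  shows "homotopy_move \<tau> (f ` A \<union> C, q, l @ map f w @ r) (f ` A' \<union> C, q, l @ map f w' @ r)"
  using assms(1)
proof cases
  case (move1 x a y)
  then have a: "a \<in> A" using assms(2) by (auto simp: is_nanoword_def)
  have "f ` (A - {a}) \<union> C = (f ` A \<union> C) - {f a}"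
    using a C \<open>inj f\<close> by (auto dest: injD)
  then show ?thesis
    using homotopy_move.move1[of \<tau> "f ` A \<union> C" q "l @ map f x" "f a" "map f y @ r"] move1 by simp
next
  case (move2 b a x y z)
  then have a: "a \<in> A" "b \<in> A" using assms(2) by (auto simp: is_nanoword_def)
  have "f ` (A - {a, b}) \<union> C = (f ` A \<union> C) - {f a, f b}"
    using a C \<open>inj f\<close> by (auto dest: injD)
  moreover have "q (f b) = \<tau> (q (f a))" using q a move2 by simp
  ultimately show ?thesis
    using homotopy_move.move2[of q "f b" \<tau> "f a" "f ` A \<union> C" "l @ map f x" "map f y" "map f z @ r"]
      move2 by simp
next
  case (move3 a b c x y z t)
  then have a: "a \<in> A" "b \<in> A" "c \<in> A" using assms(2) by (auto simp: is_nanoword_def)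
  have "distinct [f a, f b, f c]" using move3 \<open>inj f\<close> by (auto dest: injD)
  then show ?thesis
    using homotopy_move.move3[of "f a" "f b" "f c" q \<tau> "f ` A \<union> C" "l @ map f x" "map f y"
        "map f z" "map f t @ r"] move3 q a by simp
qed

lemma symmetric_phrase_map:
  assumes "symmetric_phrase \<tau> (B, p, vs)" "inj f" "set (concat vs) \<subseteq> B"
    and q: "\<And>a. a \<in> B \<Longrightarrow> q (f a) = p a"
  shows "symmetric_phrase \<tau> (f ` B, q, map (map f) vs)"
proof -
  obtain \<iota> where \<iota>: "bij_betw \<iota> B B" "\<And>v. v \<in> set vs \<Longrightarrow> map \<iota> v = rev v"
    "\<And>b. b \<in> B \<Longrightarrow> p (\<iota> b) = (\<tau> ^^ phrase_eps (B, p, vs) b) (p b)"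
    using assms(1) by (auto simp: symmetric_phrase_def)
  define j where "j = (\<lambda>n. f (\<iota> (inv_into UNIV f n)))"
  have jf: "j (f b) = f (\<iota> b)" for b by (simp add: j_def \<open>inj f\<close>)
  have "inj_on j (f ` B)" using \<iota>(1) \<open>inj f\<close> by (auto simp: bij_betw_def inj_on_def inj_def jf)
  moreover have "j ` f ` B = f ` \<iota> ` B" by (simp add: image_image jf)
  then have "j ` f ` B = f ` B" using \<iota>(1) by (simp add: bij_betw_def)
  ultimately have bij: "bij_betw j (f ` B) (f ` B)" by (simp add: bij_betw_def)
  have "map j (map f v) = rev (map f v)" if "v \<in> set vs" for v
  proof -
    have "map j (map f v) = map f (map \<iota> v)" by (simp add: jf)
    also have "\<dots> = rev (map f v)" using \<iota>(2)[OF that] by (simp add: rev_map)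
    finally show ?thesis .
  qed
  moreover have "q (j (f b)) = (\<tau> ^^ phrase_eps (f ` B, q, map (map f) vs) (f b)) (q (f b))"
    if "b \<in> B" for b
  proof -
    have "\<iota> b \<in> B" using \<iota>(1) that by (auto simp: bij_betw_def)
    moreover have "phrase_eps (f ` B, q, map (map f) vs) (f b) = phrase_eps (B, p, vs) b"
      by (simp add: phrase_eps_def count_list_map_inj \<open>inj f\<close>)
    ultimately show ?thesis using \<iota>(3)[OF that] q that by (simp add: jf)
  qed
  ultimately show ?thesis
    unfolding symmetric_phrase_def prod.case using bij by (intro exI[of _ j]) auto
qed

lemma map_concat_map2:
  "length xs = length vs \<Longrightarrow>
   map f (concat (map2 (@) xs vs)) = concat (map2 (@) (map (map f) xs) (map (map f) vs))"
  by (induction xs vs rule: list_induct2) auto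

lemma surgery_embed:
  assumes "surgery \<tau> (A, p, w) (A', p', w')" "is_nanoword (A, p, w)" "inj f"
    and q: "\<And>a. a \<in> A \<Longrightarrow> q (f a) = p a" and C: "C \<inter> f ` A = {}" "set l \<subseteq> C" "set r \<subseteq> C"
  shows "surgery \<tau> (f ` A \<union> C, q, l @ map f w @ r) (f ` A' \<union> C, q, l @ map f w' @ r)"
  using assms(1)
proof cases
  case (1 B vs xs y)
  have B: "set (concat vs) \<subseteq> B" using 1 by (simp add: is_nanophrase_def)
  define vs' where "vs' = map (map f) vs"
  define xs' where "xs' = (case map (map f) xs of [] \<Rightarrow> [] | x # xx \<Rightarrow> (l @ x) # xx)"
  define y' where "y' = (if xs = [] then l else []) @ map f y @ r"
  have len: "length xs' = length vs'"
    using 1 by (cases xs) (auto simp: xs'_def vs'_def)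
  have e1: "l @ map f w @ r = concat (map2 (@) xs' vs') @ y'"
    using 1 by (cases xs; cases vs) (simp_all add: xs'_def vs'_def y'_def map_concat_map2)
  have e2: "l @ map f w' @ r = concat xs' @ y'"
    using 1 by (cases xs) (simp_all add: xs'_def y'_def map_concat)
  have B': "f ` B \<subseteq> f ` A" "C \<inter> f ` B = {}" using 1 C by blast+
  have AB: "f ` (A - B) \<union> C = (f ` A \<union> C) - f ` B" "f ` (A - B) = f ` A - f ` B"
    using B' \<open>inj f\<close> by (auto simp: image_set_diff)
  have "set (concat xs') \<subseteq> set l \<union> f ` set (concat xs)"
    by (cases xs) (auto simp: xs'_def)
  also have "\<dots> \<subseteq> f ` (A - B) \<union> C" using C 1 by (intro Un_least) blast+
  finally have x: "set (concat xs') \<subseteq> (f ` A \<union> C) - f ` B" using AB by simp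
  have "set y' \<subseteq> f ` set y \<union> C" using C by (auto simp: y'_def)
  also have "\<dots> \<subseteq> f ` (A - B) \<union> C" using 1 by (intro Un_least) blast+
  finally have y: "set y' \<subseteq> (f ` A \<union> C) - f ` B" using AB by simp
  have "is_nanophrase (f ` B, q, vs')"
    using \<open>is_nanophrase (B, p, vs)\<close> \<open>inj f\<close>
    by (auto simp: is_nanophrase_def vs'_def map_concat[symmetric] count_list_map_inj)
  moreover have "even_phrase (f ` B, q, vs')"
    using \<open>even_phrase (B, p, vs)\<close> by (auto simp: even_phrase_def vs'_def)
  moreover have "symmetric_phrase \<tau> (f ` B, q, vs')"
    unfolding vs'_def
    by (rule symmetric_phrase_map[OF \<open>symmetric_phrase \<tau> (B, p, vs)\<close> \<open>inj f\<close> B])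
      (use q \<open>B \<subseteq> A\<close> in blast)
  moreover have "f ` B \<subseteq> f ` A \<union> C" using B' by blast
  ultimately have "surgery \<tau> (f ` A \<union> C, q, concat (map2 (@) xs' vs') @ y')
      (f ` A \<union> C - f ` B, q, concat xs' @ y')"
    by (intro surgery.intros len x y)
  then show ?thesis using e1 e2 AB 1 by simp
qed

lemma isomorphic_prod:
  assumes "isomorphic u u'" "isomorphic v v'"
  shows "isomorphic (nanoword_prod u v) (nanoword_prod u' v')"
proof -
  obtain A p w A' p' w' B q z B' q' z' where
    eq: "u = (A, p, w)" "u' = (A', p', w')" "v = (B, q, z)" "v' = (B', q', z')"
    by (cases u, cases u', cases v, cases v') blast
  obtain f g where f: "bij_betw f A A'" "\<And>a. a \<in> A \<Longrightarrow> p' (f a) = p a" "w' = map f w"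
    and g: "bij_betw g B B'" "\<And>a. a \<in> B \<Longrightarrow> q' (g a) = q a" "z' = map g z"
    using assms(1,2) by (auto simp: isomorphic_def eq)
  define h where "h = (\<lambda>n. if even n then 2 * f (n div 2) else 2 * g (n div 2) + 1)"
  have [simp]: "h (2 * n) = 2 * f n" "h (Suc (2 * n)) = Suc (2 * g n)" for n
    by (simp_all add: h_def)
  have ff: "inj_on f A" "inj_on g B" "f ` A = A'" "g ` B = B'"
    using f g by (auto simp: bij_betw_def)
  show ?thesis
    unfolding eq nanoword_prod_def prod.case
  proof (rule isomorphicI[where f = h], goal_cases)
    case 1
    show ?case
      by (rule inj_onI)
        (auto simp: inj_on_eq_iff[OF ff(1)] inj_on_eq_iff[OF ff(2)]
          double_not_eq_Suc_double Suc_double_not_eq_double)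
  next
    case (2 a)
    then show ?case using f(2) g(2) by auto
  next
    case 3
    have "h ` (\<lambda>n. 2 * n) ` A = (\<lambda>n. 2 * n) ` f ` A"
      "h ` (\<lambda>n. 2 * n + 1) ` B = (\<lambda>n. 2 * n + 1) ` g ` B"
      by (simp_all add: image_image)
    then show ?case by (simp only: image_Un ff(3,4))
  next
    case 4
    show ?case by (simp add: f(3) g(3))
  qed
qed

lemma isomorphic_refl: "isomorphic u u"
proof -
  obtain A p w where u: "u = (A, p, w)" by (metis prod_cases3)
  show ?thesis unfolding u by (rule isomorphicI[where f = id]) auto
qed

lemma even_odd_disjoint:
  "(\<lambda>n::nat. 2 * n + 1) ` B \<inter> (\<lambda>n. 2 * n) ` A = {}"
  "(\<lambda>n::nat. 2 * n) ` A \<inter> (\<lambda>n. 2 * n + 1) ` B = {}"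
  by (auto simp: double_not_eq_Suc_double Suc_double_not_eq_double)

lemma inj_even_odd: "inj (\<lambda>n::nat. 2 * n)" "inj (\<lambda>n::nat. 2 * n + 1)"
  by (auto simp: inj_def)

lemma homotopy_move_prod:
  assumes "homotopy_move \<tau> u u'" "is_nanoword u"
  shows "homotopy_move \<tau> (nanoword_prod u v) (nanoword_prod u' v)"
    and "homotopy_move \<tau> (nanoword_prod v u) (nanoword_prod v u')"
proof -
  obtain A p w A' p' w' B q z where
    eq: "u = (A, p, w)" "u' = (A', p', w')" "v = (B, q, z)"
    by (cases u, cases u', cases v) blast
  have [simp]: "p' = p" using assms(1) unfolding eq by cases auto
  note a = assms(1,2)[unfolded eq]
  show "homotopy_move \<tau> (nanoword_prod u v) (nanoword_prod u' v)"
    using homotopy_move_embed[OF a inj_even_odd(1),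
        of "\<lambda>n. if even n then p (n div 2) else q (n div 2)" "(\<lambda>n. 2 * n + 1) ` B"
          "[]" "map (\<lambda>n. 2 * n + 1) z", OF _ even_odd_disjoint(1)]
    by (simp add: eq nanoword_prod_def)
  show "homotopy_move \<tau> (nanoword_prod v u) (nanoword_prod v u')"
    using homotopy_move_embed[OF a inj_even_odd(2),
        of "\<lambda>n. if even n then q (n div 2) else p (n div 2)" "(\<lambda>n. 2 * n) ` B"
          "map (\<lambda>n. 2 * n) z" "[]", OF _ even_odd_disjoint(2)]
    by (simp add: eq nanoword_prod_def Un_commute)
qed

lemma surgery_prod:
  assumes "surgery \<tau> u u'" "is_nanoword u" "is_nanoword v"
  shows "surgery \<tau> (nanoword_prod u v) (nanoword_prod u' v)"
    and "surgery \<tau> (nanoword_prod v u) (nanoword_prod v u')"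
proof -
  obtain A p w A' p' w' B q z where
    eq: "u = (A, p, w)" "u' = (A', p', w')" "v = (B, q, z)"
    by (cases u, cases u', cases v) blast
  have [simp]: "p' = p" using assms(1) unfolding eq by cases auto
  note a = assms(1,2)[unfolded eq]
  have z: "set (map f z) \<subseteq> f ` B" for f :: "nat \<Rightarrow> nat"
    using assms(3) by (auto simp: eq is_nanoword_def)
  show "surgery \<tau> (nanoword_prod u v) (nanoword_prod u' v)"
    using surgery_embed[OF a inj_even_odd(1),
        of "\<lambda>n. if even n then p (n div 2) else q (n div 2)" "(\<lambda>n. 2 * n + 1) ` B"
          "[]" "map (\<lambda>n. 2 * n + 1) z", OF _ even_odd_disjoint(1) _ z]
    by (simp add: eq nanoword_prod_def)
  show "surgery \<tau> (nanoword_prod v u) (nanoword_prod v u')"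
    using surgery_embed[OF a inj_even_odd(2),
        of "\<lambda>n. if even n then q (n div 2) else p (n div 2)" "(\<lambda>n. 2 * n) ` B"
          "map (\<lambda>n. 2 * n) z" "[]", OF _ even_odd_disjoint(2) z]
    by (simp add: eq nanoword_prod_def Un_commute)
qed

lemma cobordism_step_prod:
  assumes "cobordism_step \<tau> u u'" "is_nanoword v"
  shows "cobordism_step \<tau> (nanoword_prod u v) (nanoword_prod u' v)"
    and "cobordism_step \<tau> (nanoword_prod v u) (nanoword_prod v u')"
  using assms unfolding cobordism_step_def
  by (metis nanoword_prod_nanoword isomorphic_prod isomorphic_refl homotopy_move_prod surgery_prod)+

lemma equiv_cobordism_rel: "equiv {u. is_nanoword u} (cobordism_rel \<tau>)"
proof (rule equivI)
  show "cobordism_rel \<tau> \<subseteq> {u. is_nanoword u} \<times> {u. is_nanoword u}"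
    unfolding cobordism_rel_def by blast
  show "refl_on {u. is_nanoword u} (cobordism_rel \<tau>)"
    unfolding refl_on_def cobordism_rel_def by simp
  show "sym (cobordism_rel \<tau>)"
    unfolding sym_def cobordism_rel_def using equivclp_sym by fast
  show "trans (cobordism_rel \<tau>)"
    unfolding trans_def cobordism_rel_def using equivclp_trans by fast
qed

lemma cobordism_relI: "cobordism_step \<tau> u v \<Longrightarrow> (u, v) \<in> cobordism_rel \<tau>"
  by (simp add: cobordism_rel_def r_into_equivclp) (simp add: cobordism_step_def)

lemma equivclp_map:
  assumes "equivclp r x y" "\<And>x y. r x y \<Longrightarrow> s (f x) (f y)"
  shows "equivclp s (f x) (f y)"
  using assms(1)
proof (induction rule: equivclp_induct)
  case (step y z)
  then show ?case using assms(2) by (meson equivclp_into_equivclp)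
qed simp

lemma cobordism_rel_prod:
  assumes "(u, u') \<in> cobordism_rel \<tau>" "(v, v') \<in> cobordism_rel \<tau>"
  shows "(nanoword_prod u v, nanoword_prod u' v') \<in> cobordism_rel \<tau>"
proof -
  have n: "is_nanoword u" "is_nanoword u'" "is_nanoword v" "is_nanoword v'"
    and e: "equivclp (cobordism_step \<tau>) u u'" "equivclp (cobordism_step \<tau>) v v'"
    using assms by (auto simp: cobordism_rel_def)
  have "equivclp (cobordism_step \<tau>) (nanoword_prod u v) (nanoword_prod u' v)"
    using equivclp_map[OF e(1), of "cobordism_step \<tau>" "\<lambda>u. nanoword_prod u v"]
      cobordism_step_prod(1) n(3) by blast
  moreover have "equivclp (cobordism_step \<tau>) (nanoword_prod u' v) (nanoword_prod u' v')"
    using equivclp_map[OF e(2), of "cobordism_step \<tau>" "nanoword_prod u'"]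
      cobordism_step_prod(2) n(2) by blast
  ultimately show ?thesis
    using n by (auto simp: cobordism_rel_def nanoword_prod_nanoword intro: equivclp_trans)
qed

lemma isomorphic_prod_assoc:
  "isomorphic (nanoword_prod (nanoword_prod u v) w) (nanoword_prod u (nanoword_prod v w))"
proof -
  obtain A p x B q y C r z where eq: "u = (A, p, x)" "v = (B, q, y)" "w = (C, r, z)"
    by (metis prod_cases3)
  define f :: "nat \<Rightarrow> nat" where
    "f = (\<lambda>n. if odd n then 2 * n + 1 else if even (n div 2) then n div 2 else n - 1)"
  have f: "f (4 * n) = 2 * n" "f (Suc (Suc (4 * n))) = Suc (4 * n)"
    "f (Suc (2 * n)) = Suc (Suc (Suc (4 * n)))" for n
    by (simp_all add: f_def)
  show ?thesis
    unfolding eq nanoword_prod_def prod.case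
  proof (rule isomorphicI[where f = f], goal_cases)
    case 1
    show ?case
      by (simp only: image_Un image_image inj_on_def Ball_def Un_iff image_iff)
        (auto simp: f; presburger)
  next
    case (2 a)
    then show ?case by (auto simp: f)
  next
    case 3
    show ?case by (simp add: image_Un image_image f Un_assoc)
  next
    case 4
    show ?case by (simp add: f)
  qed
qed

lemma isomorphic_empty_prod: "isomorphic (nanoword_prod empty_nanoword u) u"
proof -
  obtain A p w where u: "u = (A, p, w)" by (metis prod_cases3)
  show ?thesis
    unfolding u nanoword_prod_def empty_nanoword_def prod.case
    by (rule isomorphicI[where f = "\<lambda>n. n div 2"]) (auto simp: inj_on_def image_image comp_def)
qed

lemma opposite_prod_cobordant:
  assumes "is_nanoword u"
  shows "(nanoword_prod u (opposite u), empty_nanoword) \<in> cobordism_rel \<tau>"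
proof -
  obtain A p w where u: "u = (A, p, w)" by (metis prod_cases3)
  define \<iota> :: "nat \<Rightarrow> nat" where "\<iota> = (\<lambda>n. if even n then n + 1 else n - 1)"
  have \<iota>: "\<iota> (2 * n) = 2 * n + 1" "\<iota> (2 * n + 1) = 2 * n" for n by (simp_all add: \<iota>_def)
  obtain D q x where P: "nanoword_prod u (opposite u) = (D, q, x)" by (metis prod_cases3)
  then have D: "D = (\<lambda>n. 2 * n) ` A \<union> (\<lambda>n. 2 * n + 1) ` A"
    and q: "q = (\<lambda>n. p (n div 2))"
    and x: "x = map (\<lambda>n. 2 * n) w @ map (\<lambda>n. 2 * n + 1) (rev w)"
    by (auto simp: nanoword_prod_def u opposite_def)
  have nan: "is_nanoword (D, q, x)"
    using nanoword_prod_nanoword[OF assms opposite_nanoword[OF assms]] P by simp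
  have "bij_betw \<iota> D D"
    by (rule bij_betw_byWitness[where f' = \<iota>]) (auto simp: \<iota>_def D)
  moreover have "map \<iota> x = rev x"
    using \<iota> by (simp add: x rev_map comp_def)
  moreover have "q (\<iota> b) = (\<tau> ^^ phrase_eps (D, q, [x]) b) (q b)" if "b \<in> D" for b
    using that nan by (auto simp: q phrase_eps_def is_nanoword_def D \<iota>[simplified])
  ultimately have "symmetric_phrase \<tau> (D, q, [x])"
    unfolding symmetric_phrase_def by auto
  moreover have "is_nanophrase (D, q, [x])" using nan by (simp add: is_nanoword_def is_nanophrase_def)
  moreover have "even_phrase (D, q, [x])" by (simp add: even_phrase_def x)
  ultimately have "surgery \<tau> (D, q, x) ({}, q, [])"
    using surgery.intros[of D q "[x]" \<tau> D "[[]]" "[]"] by simp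
  moreover have n: "is_nanoword ({}, q, [])" by (simp add: is_nanoword_def)
  ultimately have "((D, q, x), ({}, q, [])) \<in> cobordism_rel \<tau>"
    using nan by (auto intro!: cobordism_relI simp: cobordism_step_def)
  moreover have "(({}, q, []), empty_nanoword) \<in> cobordism_rel \<tau>"
    using n empty_nanoword_nanoword
    by (auto intro!: cobordism_relI simp: cobordism_step_def isomorphic_def empty_nanoword_def bij_betw_def)
  ultimately show ?thesis
    using equiv_cobordism_rel[of \<tau>] unfolding P by (meson equivE transE)
qed

lemma cobordism_group_mult:
  assumes "is_nanoword u" "is_nanoword v"
  shows "(cobordism_rel \<tau> `` {u}) \<otimes>\<^bsub>cobordism_group \<tau>\<^esub> (cobordism_rel \<tau> `` {v})
       = cobordism_rel \<tau> `` {nanoword_prod u v}"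
proof -
  have "congruent2 (cobordism_rel \<tau>) (cobordism_rel \<tau>)
      (\<lambda>u v. cobordism_rel \<tau> `` {nanoword_prod u v})"
    by (intro congruent2I' equiv_class_eq[OF equiv_cobordism_rel] cobordism_rel_prod)
  from UN_equiv_class2[OF equiv_cobordism_rel equiv_cobordism_rel this] assms
  show ?thesis by (simp add: cobordism_group_def)
qed

theorem group_cobordism_group: "group (cobordism_group \<tau>)"
proof -
  let ?G = "cobordism_group \<tau>"
  let ?c = "\<lambda>u. cobordism_rel \<tau> `` {u}"
  note eqv = equiv_cobordism_rel[of \<tau>]
  have car: "carrier ?G = {u. is_nanoword u} // cobordism_rel \<tau>"
    and one: "\<one>\<^bsub>?G\<^esub> = ?c empty_nanoword"
    by (simp_all add: cobordism_group_def)
  have c: "?c u \<in> carrier ?G" if "is_nanoword u" for u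
    using that by (auto simp: car intro: quotientI)
  have rep: "\<exists>u. is_nanoword u \<and> X = ?c u" if "X \<in> carrier ?G" for X
    using that unfolding car by (elim quotientE) blast
  have iso: "?c u = ?c v" if "isomorphic u v" "is_nanoword u" "is_nanoword v" for u v
    using that by (intro equiv_class_eq[OF eqv] cobordism_relI) (simp add: cobordism_step_def)
  note n = nanoword_prod_nanoword empty_nanoword_nanoword opposite_nanoword
  show ?thesis
  proof (rule groupI)
    fix X Y assume "X \<in> carrier ?G" "Y \<in> carrier ?G"
    then show "X \<otimes>\<^bsub>?G\<^esub> Y \<in> carrier ?G"
      using rep c n cobordism_group_mult by metis
  next
    show "\<one>\<^bsub>?G\<^esub> \<in> carrier ?G" using c n one by simp
  next
    fix X Y Z assume "X \<in> carrier ?G" "Y \<in> carrier ?G" "Z \<in> carrier ?G"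
    then obtain u v w where "is_nanoword u" "X = ?c u" "is_nanoword v" "Y = ?c v"
      "is_nanoword w" "Z = ?c w"
      using rep by metis
    then show "X \<otimes>\<^bsub>?G\<^esub> Y \<otimes>\<^bsub>?G\<^esub> Z = X \<otimes>\<^bsub>?G\<^esub> (Y \<otimes>\<^bsub>?G\<^esub> Z)"
      using iso[OF isomorphic_prod_assoc] by (simp add: cobordism_group_mult n)
  next
    fix X assume "X \<in> carrier ?G"
    then obtain u where u: "is_nanoword u" "X = ?c u" using rep by metis
    then show "\<one>\<^bsub>?G\<^esub> \<otimes>\<^bsub>?G\<^esub> X = X"
      using iso[OF isomorphic_empty_prod] by (simp add: cobordism_group_mult n one)
    have "opposite (opposite u) = u" by (simp add: opposite_def split: prod.split)
    then have "?c (opposite u) \<otimes>\<^bsub>?G\<^esub> X = \<one>\<^bsub>?G\<^esub>"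
      using opposite_prod_cobordant[of "opposite u" \<tau>] equiv_class_eq[OF eqv] u
      by (simp add: cobordism_group_mult n one)
    then show "\<exists>Y\<in>carrier ?G. Y \<otimes>\<^bsub>?G\<^esub> X = \<one>\<^bsub>?G\<^esub>" using c n u by blast
  qed
qed

end

theory Submission
  imports Defs
begin

text \<open>
  Choose \<open>\<phi>\<close> from the letter types to the integers with \<open>\<phi> (\<tau> a) = - \<phi> a\<close> and \<open>\<phi> \<noteq> 0\<close>. Give the first
  occurrence of a letter \<open>b\<close> the weight \<open>\<phi> |b|\<close> and the second one \<open>- \<phi> |b|\<close>, and let \<open>n(a)\<close> be the
  total weight strictly between the two occurrences of \<open>a\<close>. The number of letters \<open>a\<close> with
  \<open>n(a) = k\<close> minus the number of those with \<open>n(a) = - k\<close>, each counted with the weight \<open>\<phi> |a|\<close>, is a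
  cobordism invariant: under the symmetry \<open>\<iota>\<close> of a surgery the weights along every \<open>v\<^sub>r\<close> are reversed
  with a change of sign, so they add up to \<open>0\<close> and no letter outside the factor notices its removal,
  while \<open>\<iota>\<close> changes the sign of exactly one of \<open>\<phi> |b|\<close> and \<open>n(b)\<close> for every letter \<open>b\<close> of the factor.
  The first two homotopy moves are surgeries. The invariants are additive and each nanoword has only
  finitely many nonzero ones, so on a finitely generated group almost all of them would vanish;
  but the word \<open>a b\<^sub>1 \<dots> b\<^sub>n a b\<^sub>n \<dots> b\<^sub>1\<close> has \<open>n(a) = n\<close> and \<open>n(b\<^sub>i) = - 1\<close>.
\<close>

section \<open>Signed words and the linking count\<close>

text \<open>The set \<open>s\<close> records the letters already met, so that a block inside a word
  can be signed without its prefix; a whole word starts with \<open>{}\<close>.\<close>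

fun signed :: "nat set \<Rightarrow> nat list \<Rightarrow> (nat \<times> int) list" where
  "signed s [] = []"
| "signed s (a # w) = (a, if a \<in> s then - 1 else 1) # signed (insert a s) w"

definition weight_sum :: "(nat \<Rightarrow> int) \<Rightarrow> (nat \<times> int) list \<Rightarrow> int" where
  "weight_sum f V = (\<Sum>(b, s)\<leftarrow>V. s * f b)"

definition sign_sum :: "nat \<Rightarrow> (nat \<times> int) list \<Rightarrow> int" where
  "sign_sum a V = (\<Sum>(b, s)\<leftarrow>V. if b = a then s else 0)"

text \<open>
  For a letter \<open>a\<close> occurring twice the value is \<open>- 2 * n(a)\<close>, whatever \<open>c\<close> is. Here \<open>c\<close> is
  the weight of the preceding letters; the term \<open>2 * c + s * f b\<close> adds the prefix weights without and
  with the current letter, which makes the value behave well under reversal (see \<open>linking_rev\<close>).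
\<close>

fun linking :: "(nat \<Rightarrow> int) \<Rightarrow> nat \<Rightarrow> int \<Rightarrow> (nat \<times> int) list \<Rightarrow> int" where
  "linking f a c [] = 0"
| "linking f a c ((b, s) # V) =
     (if b = a then s * (2 * c + s * f b) else 0) + linking f a (c + s * f b) V"

text \<open>Being odd in \<open>m\<close> is the point: it lets the letters of a symmetric factor
  cancel.\<close>

definition odd_indicator :: "int \<Rightarrow> int \<Rightarrow> int" where
  "odd_indicator k m = of_bool (m = k) - of_bool (m = - k)"

text \<open>The index is on the scale of \<open>linking\<close>: because of the factor
  \<open>- 2\<close>, on nanowords the index \<open>2 * m\<close> gives, up to sign, the count at
  \<open>m\<close> described at the beginning.\<close>

definition linking_count :: "('a \<Rightarrow> int) \<Rightarrow> int \<Rightarrow> 'a nanoword \<Rightarrow> int" where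
  "linking_count \<phi> k = (\<lambda>(A, p, w).
     \<Sum>a\<in>A. \<phi> (p a) * odd_indicator k (linking (\<phi> \<circ> p) a 0 (signed {} w)))"

section \<open>Concatenation, reversal and renaming of signed words\<close>

lemma weight_sum_simps [simp]:
  "weight_sum f [] = 0" "weight_sum f ((b, s) # V) = s * f b + weight_sum f V"
  "weight_sum f (V @ W) = weight_sum f V + weight_sum f W" "weight_sum f (rev V) = weight_sum f V"
  by (simp_all add: weight_sum_def rev_map[symmetric])

lemma sign_sum_simps [simp]:
  "sign_sum a [] = 0" "sign_sum a ((b, s) # V) = (if b = a then s else 0) + sign_sum a V"
  "sign_sum a (V @ W) = sign_sum a V + sign_sum a W" "sign_sum a (rev V) = sign_sum a V"
  by (simp_all add: sign_sum_def rev_map[symmetric])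

lemma linking_append [simp]:
  "linking f a c (V @ W) = linking f a c V + linking f a (c + weight_sum f V) W"
  by (induction f a c V rule: linking.induct) (simp_all add: add.assoc)

text \<open>The starting weight enters each term at \<open>a\<close> as \<open>2 * c * s\<close>.
  Hence a block need only be studied for \<open>c = 0\<close>.\<close>

lemma linking_shift: "linking f a c V = linking f a 0 V + 2 * c * sign_sum a V"
proof (induction V arbitrary: c)
  case (Cons x V)
  obtain b s where x: "x = (b, s)" by force
  show ?case
    using Cons[of "c + s * f b"] Cons[of "s * f b"] by (simp add: x algebra_simps)
qed simp

text \<open>An entry with prefix weights \<open>P\<close> before and \<open>P'\<close> after it
  contributes \<open>s * (P + P')\<close>. In the reversed list, with total weight \<open>T\<close>,
  these become \<open>T - P'\<close> and \<open>T - P\<close>, so the entry contributes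
  \<open>s * (2 * T - P - P')\<close>.\<close>

lemma linking_rev:
  "linking f a 0 (rev V) = 2 * weight_sum f V * sign_sum a V - linking f a 0 V"
proof (induction V)
  case (Cons x V)
  obtain b s where x: "x = (b, s)" by force
  show ?case
    using Cons linking_shift[of f a "s * f b" V] by (simp add: x algebra_simps)
qed simp

lemma linking_eq_0: "a \<notin> fst ` set V \<Longrightarrow> linking f a c V = 0"
  by (induction f a c V rule: linking.induct) auto

lemma length_signed [simp]: "length (signed s w) = length w"
  by (induction s w rule: signed.induct) auto

lemma map_fst_signed [simp]: "map fst (signed s w) = w"
  by (induction s w rule: signed.induct) auto

lemma fst_set_signed [simp]: "fst ` set (signed s w) = set w"
  by (metis list.set_map map_fst_signed)

lemma fst_set_map_apfst: "fst ` set (map (apfst h) V) = h ` fst ` set V"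
  by (simp add: image_image)

lemma signed_append [simp]: "signed s (v @ w) = signed s v @ signed (s \<union> set v) w"
  by (induction s v rule: signed.induct) auto

lemma signed_cong: "s \<inter> set w = t \<inter> set w \<Longrightarrow> signed s w = signed t w"
proof (induction w arbitrary: s t)
  case (Cons a w)
  have "signed (insert a s) w = signed (insert a t) w"
    using Cons.prems by (intro Cons.IH) auto
  then show ?case using Cons.prems by auto
qed simp

lemma nth_signed:
  "i < length w \<Longrightarrow>
   signed s w ! i = (w ! i, if w ! i \<in> s \<union> set (take i w) then - 1 else 1)"
proof (induction w arbitrary: s i)
  case (Cons a w)
  then show ?case by (cases i) auto
qed simp

lemma signed_map:
  "inj_on h (s \<union> set w) \<Longrightarrow> signed (h ` s) (map h w) = map (apfst h) (signed s w)"
proof (induction w arbitrary: s)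
  case (Cons a w)
  have "h a \<in> h ` s \<longleftrightarrow> a \<in> s"
    using Cons.prems by (intro inj_on_image_mem_iff[where B = "s \<union> set (a # w)"]) auto
  then show ?case using Cons.IH[of "insert a s"] Cons.prems by simp
qed simp

lemma linking_map:
  assumes "inj_on h (insert a (fst ` set V))" "\<And>b. b \<in> fst ` set V \<Longrightarrow> g (h b) = f b"
  shows "linking g (h a) c (map (apfst h) V) = linking f a c V"
  using assms
proof (induction V arbitrary: c)
  case (Cons x V)
  obtain b s where x: "x = (b, s)" by force
  have "h b = h a \<longleftrightarrow> b = a"
    using inj_on_eq_iff[OF Cons.prems(1), of b a] by (simp add: x)
  moreover have "inj_on h (insert a (fst ` set V))"
    using Cons.prems(1) by (rule inj_on_subset) auto
  ultimately show ?case using Cons by (simp add: x)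
qed simp

lemma weight_sum_eq_sum:
  assumes "finite A" "fst ` set V \<subseteq> A"
  shows "weight_sum f V = (\<Sum>a\<in>A. f a * sign_sum a V)"
  using assms(2)
proof (induction V)
  case (Cons x V)
  obtain b s where x: "x = (b, s)" by force
  have "(\<Sum>a\<in>A. f a * (if b = a then s else 0)) = f b * s"
    using Cons.prems assms(1) by (simp add: x if_distrib cong: if_cong)
  then show ?case using Cons by (simp add: x distrib_left sum.distrib)
qed simp

text \<open>For a letter not met before, the first occurrence counts \<open>1\<close> and each
  further one \<open>- 1\<close>; two occurrences cancel.\<close>

lemma sign_sum_signed:
  "sign_sum a (signed s w) =
    (if a \<in> s then - int (count_list w a)
     else if a \<in> set w then 2 - int (count_list w a) else 0)"
proof (induction w arbitrary: s)
  case (Cons b w)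
  then show ?case using count_list_0_iff[of w a] by auto
qed simp

lemma nanoword_set: "is_nanoword (A, p, w) \<Longrightarrow> set w = A"
  unfolding is_nanoword_def prod.case
  by (metis count_list_0_iff subsetI subset_antisym zero_neq_numeral)

lemma nanoword_finite: "is_nanoword (A, p, w) \<Longrightarrow> finite A"
  using nanoword_set by (metis finite_set)

text \<open>The two occurrences of each letter have opposite signs. Thus a nanoword placed in front
  of another one does not shift its prefix weights.\<close>

lemma weight_sum_nanoword:
  assumes "is_nanoword (A, p, w)"
  shows "weight_sum f (signed {} w) = 0"
proof -
  have "sign_sum a (signed {} w) = 0" if "a \<in> A" for a
    using assms that by (auto simp: sign_sum_signed is_nanoword_def)
  then show ?thesis
    using weight_sum_eq_sum[OF nanoword_finite[OF assms], of "signed {} w" f] nanoword_set[OF assms]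
    by simp
qed

text \<open>For \<open>e = 1\<close> only the linking value changes sign, for \<open>e = - 1\<close>
  only the weight does.\<close>

lemma odd_indicator_twist:
  assumes "e * e = 1"
  shows "e * x * odd_indicator k (- e * m) = - (x * odd_indicator k m)"
proof -
  have "e = 1 \<or> e = - 1" using assms by (simp add: square_eq_1_iff)
  then show ?thesis by (auto simp: odd_indicator_def)
qed

section \<open>Isomorphisms and products\<close>

lemma linking_count_isomorphic:
  assumes "isomorphic u v" "is_nanoword u"
  shows "linking_count \<phi> k u = linking_count \<phi> k v"
proof -
  obtain A p w A' p' w' where eq: "u = (A, p, w)" "v = (A', p', w')"
    by (cases u, cases v) blast
  obtain h where h: "bij_betw h A A'" "\<And>a. a \<in> A \<Longrightarrow> p' (h a) = p a" "w' = map h w"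
    using assms(1) by (auto simp: isomorphic_def eq)
  have A: "set w = A" using assms(2) nanoword_set eq by blast
  have inj: "inj_on h A" using h(1) by (simp add: bij_betw_def)
  have "linking (\<phi> \<circ> p') (h a) 0 (signed {} w') = linking (\<phi> \<circ> p) a 0 (signed {} w)"
    if "a \<in> A" for a
  proof -
    have "signed {} w' = map (apfst h) (signed {} w)"
      using signed_map[of h "{}" w] inj by (simp add: h(3) A)
    then show ?thesis
      using linking_map[of h a "signed {} w" "\<phi> \<circ> p'" "\<phi> \<circ> p"] inj h(2) that
      by (simp add: A insert_absorb)
  qed
  then have "linking_count \<phi> k v = linking_count \<phi> k u"
    unfolding linking_count_def eq prod.case
    by (subst sum.reindex_bij_betw[OF h(1), symmetric]) (simp add: h(2) cong: sum.cong)
  then show ?thesis by simp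
qed

text \<open>The alphabets are made disjoint and the first factor has total weight \<open>0\<close>,
  so every letter keeps its linking value.\<close>

lemma linking_count_prod:
  assumes "is_nanoword u" "is_nanoword v"
  shows "linking_count \<phi> k (nanoword_prod u v) = linking_count \<phi> k u + linking_count \<phi> k v"
proof -
  obtain A p w B q z where eq: "u = (A, p, w)" "v = (B, q, z)"
    by (cases u, cases v) blast
  let ?e = "\<lambda>n::nat. 2 * n" and ?o = "\<lambda>n::nat. 2 * n + 1"
  define r where "r = (\<lambda>n. if even n then p (n div 2) else q (n div 2))"
  have r: "r (?e n) = p n" "r (?o n) = q n" for n by (simp_all add: r_def)
  have A: "set w = A" "finite A" and B: "set z = B" "finite B"
    using assms nanoword_set nanoword_finite eq by blast+
  have inj: "inj_on ?e C" "inj_on ?o C" for C by (auto simp: inj_on_def)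
  have sw: "signed {} (map ?e w) = map (apfst ?e) (signed {} w)"
    using signed_map[of ?e "{}" w, OF inj(1)] by simp
  have sz: "signed (set (map ?e w)) (map ?o z) = map (apfst ?o) (signed {} z)"
    using signed_map[of ?o "{}" z, OF inj(2)] even_odd_disjoint[of A B]
    by (subst signed_cong[of _ _ "{}"]) (simp_all add: A B)
  let ?W = "map (apfst ?e) (signed {} w)" and ?Z = "map (apfst ?o) (signed {} z)"
  have s: "signed {} (map ?e w @ map ?o z) = ?W @ ?Z"
    using sw sz by simp
  have "weight_sum (\<phi> \<circ> r) ?W = weight_sum (\<phi> \<circ> p) (signed {} w)"
    by (simp add: weight_sum_def comp_def case_prod_unfold r_def)
  then have T: "weight_sum (\<phi> \<circ> r) ?W = 0"
    using weight_sum_nanoword assms(1) eq by simp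
  have Zo: "fst ` set ?Z = ?o ` B" and We: "fst ` set ?W = ?e ` A"
    using A(1) B(1) fst_set_signed by (simp_all only: fst_set_map_apfst)
  have 1: "linking (\<phi> \<circ> r) (?e a) 0 (?W @ ?Z) = linking (\<phi> \<circ> p) a 0 (signed {} w)"
    if "a \<in> A" for a
  proof -
    have "?e a \<notin> fst ` set ?Z"
      unfolding Zo using even_odd_disjoint(1)[of B A] that by blast
    from linking_eq_0[OF this] show ?thesis
      using linking_map[of ?e a "signed {} w" "\<phi> \<circ> r" "\<phi> \<circ> p", OF inj(1)]
      by (simp add: r_def)
  qed
  have 2: "linking (\<phi> \<circ> r) (?o b) 0 (?W @ ?Z) = linking (\<phi> \<circ> q) b 0 (signed {} z)"
    if "b \<in> B" for b
  proof -
    have "?o b \<notin> fst ` set ?W"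
      unfolding We using even_odd_disjoint(1)[of B A] that by blast
    from linking_eq_0[OF this] show ?thesis
      using linking_map[of ?o b "signed {} z" "\<phi> \<circ> r" "\<phi> \<circ> q", OF inj(2)] T
      by (simp add: r_def)
  qed
  have "linking_count \<phi> k (nanoword_prod u v) =
      (\<Sum>a\<in>?e ` A \<union> ?o ` B. \<phi> (r a) * odd_indicator k (linking (\<phi> \<circ> r) a 0 (?W @ ?Z)))"
    unfolding linking_count_def eq nanoword_prod_def prod.case r_def[symmetric] s ..
  also have "\<dots> =
      (\<Sum>a\<in>?e ` A. \<phi> (r a) * odd_indicator k (linking (\<phi> \<circ> r) a 0 (?W @ ?Z))) +
      (\<Sum>a\<in>?o ` B. \<phi> (r a) * odd_indicator k (linking (\<phi> \<circ> r) a 0 (?W @ ?Z)))"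
    using A B even_odd_disjoint by (intro sum.union_disjoint) auto
  also have "\<dots> = linking_count \<phi> k u + linking_count \<phi> k v"
    unfolding linking_count_def eq prod.case sum.reindex[OF inj(1)] sum.reindex[OF inj(2)]
    by (intro arg_cong2[where f = "(+)"] sum.cong refl) (simp_all only: comp_apply 1 2 r)
  finally show ?thesis .
qed

section \<open>The third homotopy move\<close>

text \<open>Each of \<open>a\<close>, \<open>b\<close>, \<open>c\<close> takes part in two of the
  three transpositions, and as their weights agree, the two changes of its linking value cancel. Any
  other letter sees only the total weight of a transposed pair.\<close>

lemma linking_count_move3:
  assumes "is_nanoword (A, p, x @ [a, b] @ y @ [a, c] @ z @ [b, c] @ t)"
    and "distinct [a, b, c]" "p a = p b" "p b = p c"
  shows "linking_count \<phi> k (A, p, x @ [a, b] @ y @ [a, c] @ z @ [b, c] @ t) =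
    linking_count \<phi> k (A, p, x @ [b, a] @ y @ [c, a] @ z @ [c, b] @ t)"
proof -
  let ?w = "x @ [a, b] @ y @ [a, c] @ z @ [b, c] @ t"
  let ?w' = "x @ [b, a] @ y @ [c, a] @ z @ [c, b] @ t"
  have A: "set ?w = A" using assms(1) by (rule nanoword_set)
  have "count_list ?w d = 2" if "d \<in> {a, b, c}" for d
  proof -
    have "d \<in> A" using that unfolding A[symmetric] by auto
    then show ?thesis using assms(1) by (simp only: is_nanoword_def prod.case)
  qed
  from this[of a] this[of b] this[of c] have n: "a \<notin> set x" "b \<notin> set x" "c \<notin> set x" "a \<notin> set y" "b \<notin> set y" "c \<notin> set y"
    "a \<notin> set z" "b \<notin> set z" "c \<notin> set z"
    using assms(2) by (auto simp: count_list_0_iff[symmetric])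
  have ne: "a \<noteq> b" "a \<noteq> c" "b \<noteq> c" "b \<noteq> a" "c \<noteq> a" "c \<noteq> b" using assms(2) by auto
  have f: "\<phi> (p b) = \<phi> (p a)" "\<phi> (p c) = \<phi> (p a)" using assms(3,4) by simp_all
  \<comment> \<open>After each transposed pair the same letters have been met in both words, so the
    blocks in between carry the same signs.\<close>
  define X where "X = signed {} x"
  define Y where "Y = signed (insert a (insert b (set x))) y"
  define Z where "Z = signed (insert a (insert b (insert c (set x \<union> set y)))) z"
  define U where "U = signed (insert a (insert b (insert c (set x \<union> set y \<union> set z)))) t"
  have W: "signed {} ?w = X @ [(a, 1), (b, 1)] @ Y @ [(a, - 1), (c, 1)] @ Z @ [(b, - 1), (c, - 1)] @ U"
    using n ne by (simp add: X_def Y_def Z_def U_def insert_commute Un_insert_right)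
  have W': "signed {} ?w' = X @ [(b, 1), (a, 1)] @ Y @ [(c, 1), (a, - 1)] @ Z @ [(c, - 1), (b, - 1)] @ U"
    using n ne by (simp add: X_def Y_def Z_def U_def insert_commute Un_insert_right)
  have "linking (\<phi> \<circ> p) d 0 (signed {} ?w) = linking (\<phi> \<circ> p) d 0 (signed {} ?w')" for d
    unfolding W W' using ne by (simp add: f algebra_simps)
  then show ?thesis by (simp only: linking_count_def prod.case)
qed

section \<open>Symmetric factors and surgeries\<close>

text \<open>If both occurrences of \<open>b\<close> lie in \<open>v\<close>, reversal sends the
  first one to the second occurrence of \<open>\<iota> b\<close>, and the sign flips. If only one
  does, its sign depends on \<open>s\<close> alone, where \<open>b\<close> and
  \<open>\<iota> b\<close> behave alike, and is kept.\<close>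

lemma rev_signed:
  assumes v: "map \<iota> v = rev v" and inj: "inj_on \<iota> (set v)"
    and e: "\<And>b. b \<in> set v \<Longrightarrow>
      e b = 1 \<and> count_list v b = 2 \<and> b \<notin> s \<and> \<iota> b \<notin> s \<or>
      e b = - 1 \<and> count_list v b = 1 \<and> (b \<in> s \<longleftrightarrow> \<iota> b \<in> s)"
  shows "rev (signed s v) = map (\<lambda>(b, t). (\<iota> b, - e b * t)) (signed s v)"
proof (rule nth_equalityI)
  fix i assume "i < length (rev (signed s v))"
  then have i: "i < length v" by simp
  define b where "b = v ! i"
  define j where "j = length v - Suc i"
  have j: "j < length v" using i by (simp add: j_def)
  have b: "b \<in> set v" using i by (simp add: b_def)
  have vj: "v ! j = \<iota> b"
    using i v nth_map[of i v \<iota>] rev_nth[of i v] by (simp add: b_def j_def)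
  have split: "v = take i v @ b # drop (Suc i) v"
    using i by (simp add: b_def id_take_nth_drop[symmetric])
  have sub: "set (take i v) \<subseteq> set v" "set (drop (Suc i) v) \<subseteq> set v"
    by (rule set_take_subset, rule set_drop_subset)
  \<comment> \<open>What precedes the mirror position \<open>j\<close> is the mirror image of what
    follows \<open>i\<close>; so \<open>\<iota> b\<close> is met before \<open>j\<close> exactly if
    \<open>b\<close> occurs again after \<open>i\<close>.\<close>
  have "take j v = take j (rev (map \<iota> v))" using v by simp
  also have "\<dots> = map \<iota> (rev (drop (Suc i) v))"
    by (simp add: j_def rev_drop take_map rev_map)
  finally have "\<iota> b \<in> set (take j v) \<longleftrightarrow> \<iota> b \<in> \<iota> ` set (drop (Suc i) v)" by simp
  also have "\<dots> \<longleftrightarrow> b \<in> set (drop (Suc i) v)"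
    using inj_on_image_mem_iff[OF inj b sub(2)] .
  finally have tj: "\<iota> b \<in> set (take j v) \<longleftrightarrow> b \<in> set (drop (Suc i) v)" .
  have "count_list v b = count_list (take i v) b + 1 + count_list (drop (Suc i) v) b"
    by (subst split) simp
  then have "(if \<iota> b \<in> s \<union> set (take j v) then - 1 else 1) =
      - e b * (if b \<in> s \<union> set (take i v) then - 1 else 1)"
    using e[OF b] tj count_list_0_iff[of "take i v" b] count_list_0_iff[of "drop (Suc i) v" b]
    by auto
  then show "rev (signed s v) ! i = map (\<lambda>(b, t). (\<iota> b, - e b * t)) (signed s v) ! i"
    using i j by (simp add: rev_nth nth_signed vj[symmetric] j_def[symmetric])
      (simp add: vj b_def[symmetric])
qed simp

text \<open>The map in \<open>V\<close> negates every signed weight, since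
  \<open>e b * e b = 1\<close>, while reversal keeps the total; so the total is its own negative.
  With total \<open>0\<close>, \<open>linking_rev\<close> turns reversal into a change of sign, and
  the map itself contributes the factor \<open>e b\<close>.\<close>

lemma symmetric_block:
  assumes V: "rev V = map (\<lambda>(b, t). (\<iota> b, - e b * t)) V"
    and f: "\<And>b. b \<in> fst ` set V \<Longrightarrow> f (\<iota> b) = e b * f b" "\<And>b. b \<in> fst ` set V \<Longrightarrow> e b * e b = 1"
  shows "weight_sum f V = 0"
    and "inj_on \<iota> (insert b (fst ` set V)) \<Longrightarrow>
      linking f (\<iota> b) c V = - e b * linking f b c V"
proof -
  let ?\<Phi> = "\<lambda>(b, t). (\<iota> b, - e b * t)"
  have "weight_sum f (map ?\<Phi> W) = - weight_sum f W" if "set W \<subseteq> set V" for W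
    using that
  proof (induction W)
    case (Cons x W)
    obtain b t where x: "x = (b, t)" by force
    have "b \<in> fst ` set V" using Cons.prems by (force simp: x)
    then have "- e b * t * f (\<iota> b) = - (e b * e b) * (t * f b)"
      using f(1) by simp
    also have "\<dots> = - (t * f b)" using f(2) \<open>b \<in> fst ` set V\<close> by simp
    finally have "- e b * t * f (\<iota> b) = - (t * f b)" .
    then show ?case using Cons by (simp add: x)
  qed simp
  from this[of V] show T: "weight_sum f V = 0" using V weight_sum_simps(4)[of f V] by simp
  assume inj: "inj_on \<iota> (insert b (fst ` set V))"
  \<comment> \<open>Prefix weights are negated by \<open>?\<Phi>\<close>, so the starting weight
    must be negated too.\<close>
  have 1: "linking f (\<iota> b) (- c) (map ?\<Phi> W) = e b * linking f b c W"
    if "set W \<subseteq> set V" for W c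
    using that
  proof (induction W arbitrary: c)
    case (Cons x W)
    obtain d t where x: "x = (d, t)" by force
    have d: "d \<in> fst ` set V" using Cons.prems by (force simp: x)
    then have "- e d * t * f (\<iota> d) = - (e d * e d) * (t * f d)"
      using f(1) by simp
    also have "\<dots> = - (t * f d)" using f(2) d by simp
    finally have m: "- e d * t * f (\<iota> d) = - (t * f d)" .
    have "\<iota> d = \<iota> b \<longleftrightarrow> d = b"
      using inj_on_eq_iff[OF inj, of d b] d by simp
    then have "linking f (\<iota> b) (- c) (map ?\<Phi> (x # W)) =
        (if d = b then - e d * t * (2 * - c + - e d * t * f (\<iota> d)) else 0) +
        linking f (\<iota> b) (- c + - e d * t * f (\<iota> d)) (map ?\<Phi> W)"
      by (simp add: x)
    also have "\<dots> = (if d = b then - e d * t * (2 * - c + - (t * f d)) else 0) +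
        linking f (\<iota> b) (- (c + t * f d)) (map ?\<Phi> W)"
      unfolding m by simp
    also have "linking f (\<iota> b) (- (c + t * f d)) (map ?\<Phi> W) = e b * linking f b (c + t * f d) W"
      using Cons.prems by (intro Cons.IH) simp
    also have "(if d = b then - e d * t * (2 * - c + - (t * f d)) else 0) =
        e b * (if d = b then t * (2 * c + t * f d) else 0)"
      by (simp add: algebra_simps)
    finally show ?case by (simp add: x distrib_left)
  qed simp
  \<comment> \<open>Sign sums scale by the same factor \<open>- e b\<close>, which extends the case
    \<open>c = 0\<close> to all \<open>c\<close> by \<open>linking_shift\<close>.\<close>
  have 2: "sign_sum (\<iota> b) (map ?\<Phi> W) = - e b * sign_sum b W" if "set W \<subseteq> set V" for W
    using that
  proof (induction W)
    case (Cons x W)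
    obtain d t where x: "x = (d, t)" by force
    have d: "d \<in> fst ` set V" using Cons.prems by (force simp: x)
    have "\<iota> d = \<iota> b \<longleftrightarrow> d = b"
      using inj_on_eq_iff[OF inj, of d b] d by simp
    then show ?case using Cons by (simp add: x algebra_simps)
  qed simp
  have "linking f (\<iota> b) 0 V = - linking f (\<iota> b) 0 (rev V)"
    using linking_rev[of f "\<iota> b" V] T by simp
  also have "\<dots> = - e b * linking f b 0 V"
    unfolding V using 1[of V 0] by simp
  finally have 3: "linking f (\<iota> b) 0 V = - e b * linking f b 0 V" .
  have "sign_sum (\<iota> b) V = - e b * sign_sum b V"
    using 2[of V] V sign_sum_simps(4)[of "\<iota> b" V] by simp
  then show "linking f (\<iota> b) c V = - e b * linking f b c V"
    using 3 linking_shift[of f "\<iota> b" c V] linking_shift[of f b c V] by (simp add: algebra_simps)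
qed

text \<open>
  The sign \<open>e b\<close> is \<open>1\<close> if both occurrences of \<open>b\<close> are in the same \<open>v\<^sub>r\<close> (so \<open>\<iota>\<close> exchanges first and
  second occurrences) and \<open>- 1\<close> otherwise (so \<open>\<iota>\<close> preserves them).
\<close>

lemma linking_symmetric_factor:
  assumes "length xs = length vs"
    and "set (concat xs) \<inter> B = {}" "set (concat vs) \<subseteq> B" "s - B = t - B"
    and inj: "inj_on \<iota> B" and im: "\<iota> ` B \<subseteq> B"
    and f: "\<And>b. b \<in> B \<Longrightarrow> f (\<iota> b) = e b * f b" "\<And>b. b \<in> B \<Longrightarrow> e b * e b = 1"
    and "\<And>us v ws. vs = us @ v # ws \<Longrightarrow>
      rev (signed (s \<union> set (concat us)) v) =
      map (\<lambda>(b, t). (\<iota> b, - e b * t)) (signed (s \<union> set (concat us)) v)"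
    and y: "set y \<inter> B = {}"
  shows "a \<notin> B \<Longrightarrow> linking f a c (signed s (concat (map2 (@) xs vs) @ y)) =
      linking f a c (signed t (concat xs @ y))"
    and "b \<in> B \<Longrightarrow> linking f (\<iota> b) c (signed s (concat (map2 (@) xs vs) @ y)) =
      - e b * linking f b c (signed s (concat (map2 (@) xs vs) @ y))"
proof -
  \<comment> \<open>Induction over the blocks. The letters met in the full and in the reduced word
    differ only by letters of \<open>B\<close>, hence the invariant
    \<open>s - B = t - B\<close>.\<close>
  have "(\<forall>a. a \<notin> B \<longrightarrow> linking f a c (signed s (concat (map2 (@) xs vs) @ y)) =
      linking f a c (signed t (concat xs @ y))) \<and>
    (\<forall>b\<in>B. linking f (\<iota> b) c (signed s (concat (map2 (@) xs vs) @ y)) =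
      - e b * linking f b c (signed s (concat (map2 (@) xs vs) @ y)))"
    using assms(1-4,9)
  proof (induction xs vs arbitrary: s t c rule: list_induct2)
    case Nil
    have "signed s y = signed t y"
      using Nil(3) y by (intro signed_cong) blast
    moreover have "linking f b c (signed s y) = 0" if "b \<in> B" for b c
      using that y by (intro linking_eq_0) auto
    ultimately show ?case using im by auto
  next
    case (Cons x xs v vs)
    have x: "set x \<inter> B = {}" and v: "set v \<subseteq> B" using Cons.prems(1,2) by auto
    let ?X = "signed s x" and ?V = "signed (s \<union> set x) v"
    let ?s = "s \<union> set x \<union> set v"
    let ?R = "signed ?s (concat (map2 (@) xs vs) @ y)"
    let ?R' = "signed (t \<union> set x) (concat xs @ y)"
    have X: "?X = signed t x"
      using Cons.prems(3) x by (intro signed_cong) blast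
    \<comment> \<open>The letters of \<open>x\<close> lie outside \<open>B\<close> and do not affect
      signs inside a block, so the reversal hypothesis applies although it ignores them.\<close>
    have "?V = signed s v"
      using v x by (intro signed_cong) blast
    then have V: "rev ?V = map (\<lambda>(b, t). (\<iota> b, - e b * t)) ?V"
      using Cons.prems(4)[of "[]" v vs] by simp
    \<comment> \<open>Because of this, the prefix weights after the block agree in both
      words.\<close>
    have T: "weight_sum f ?V = 0"
      using symmetric_block(1)[OF V, of f] f v by auto
    have fV: "fst ` set ?V = set v" and fX: "fst ` set ?X = set x" by simp_all
    have LV: "linking f (\<iota> b) c ?V = - e b * linking f b c ?V" if "b \<in> B" for b c
    proof (rule symmetric_block(2)[OF V])
      show "inj_on \<iota> (insert b (fst ` set ?V))"
        unfolding fV by (rule inj_on_subset[OF inj]) (use v that in blast)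
    qed (use f v in auto)
    have "(\<forall>a. a \<notin> B \<longrightarrow> linking f a (c + weight_sum f ?X) ?R = linking f a (c + weight_sum f ?X) ?R') \<and>
      (\<forall>b\<in>B. linking f (\<iota> b) (c + weight_sum f ?X) ?R = - e b * linking f b (c + weight_sum f ?X) ?R)"
    proof (rule Cons.IH)
      show "set (concat xs) \<inter> B = {}" "set (concat vs) \<subseteq> B" using Cons.prems(1,2) by auto
      show "?s - B = t \<union> set x - B" using Cons.prems(3) x v by blast
      fix us u ws assume vs: "vs = us @ u # ws"
      then have u: "set u \<subseteq> B" using Cons.prems(2) by auto
      have "signed (?s \<union> set (concat us)) u = signed (s \<union> set (concat (v # us))) u"
        using u x by (intro signed_cong) auto
      then show "rev (signed (?s \<union> set (concat us)) u) =
          map (\<lambda>(b, t). (\<iota> b, - e b * t)) (signed (?s \<union> set (concat us)) u)"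
        using Cons.prems(4)[of "v # us" u ws] vs by simp
    qed
    moreover have "linking f b c ?X = 0" if "b \<in> B" for b c
      using that x by (intro linking_eq_0) auto
    moreover have "linking f a c ?V = 0" if "a \<notin> B" for a c
      using that v by (intro linking_eq_0) auto
    moreover have "\<iota> b \<in> B" if "b \<in> B" for b using that im by blast
    moreover have "signed s (concat (map2 (@) (x # xs) (v # vs)) @ y) = ?X @ ?V @ ?R"
      by (simp add: Un_assoc)
    moreover have "signed t (concat (x # xs) @ y) = ?X @ ?R'"
      by (simp add: X Un_assoc)
    ultimately show ?case
      using LV by (simp only: linking_append T add_0_right add_0_left) (simp add: distrib_left)
  qed
  then show "a \<notin> B \<Longrightarrow> linking f a c (signed s (concat (map2 (@) xs vs) @ y)) =
      linking f a c (signed t (concat xs @ y))"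
    and "b \<in> B \<Longrightarrow> linking f (\<iota> b) c (signed s (concat (map2 (@) xs vs) @ y)) =
      - e b * linking f b c (signed s (concat (map2 (@) xs vs) @ y))"
    by blast+
qed

text \<open>As \<open>\<iota>\<close> permutes the letters of every block, \<open>b\<close> and
  \<open>\<iota> b\<close> occur in the same blocks. The two values of \<open>phrase_eps\<close>
  then yield the two cases of \<open>rev_signed\<close>.\<close>

lemma symmetric_phrase_rev_signed:
  assumes ph: "is_nanophrase (B, p, vs)"
    and inj: "inj_on \<iota> B" and \<iota>: "\<And>v. v \<in> set vs \<Longrightarrow> map \<iota> v = rev v"
    and vs: "vs = us @ v # ws"
  defines "e \<equiv> \<lambda>b. if phrase_eps (B, p, vs) b = 0 then 1 else - 1"
  shows "rev (signed (set (concat us)) v) =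
    map (\<lambda>(b, t). (\<iota> b, - e b * t)) (signed (set (concat us)) v)"
proof (rule rev_signed)
  show "map \<iota> v = rev v" using \<iota> vs by simp
  have sub: "set u \<subseteq> B" if "u \<in> set vs" for u
    using ph that by (auto simp: is_nanophrase_def)
  show "inj_on \<iota> (set v)" using inj_on_subset[OF inj sub] vs by simp
  fix b assume b: "b \<in> set v"
  then have bB: "b \<in> B" using sub[of v] vs by auto
  have mem: "\<iota> b \<in> set u \<longleftrightarrow> b \<in> set u" if "u \<in> set vs" for u
  proof -
    have "set u = \<iota> ` set u" using \<iota>[OF that] by (metis list.set_map set_rev)
    then show ?thesis using inj_on_image_mem_iff[OF inj bB sub[OF that]] by simp
  qed
  then have us: "\<iota> b \<in> set (concat us) \<longleftrightarrow> b \<in> set (concat us)"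
    using vs by auto
  have "count_list (concat vs) b = 2" using ph bB by (simp add: is_nanophrase_def)
  then have c: "count_list (concat us) b + count_list v b + count_list (concat ws) b = 2"
    by (simp add: vs)
  have v1: "count_list v b \<ge> 1" using b count_list_0_iff[of v b] by linarith
  have le: "count_list u b \<le> count_list (concat l) b" if "u \<in> set l" for u l
    using that by (induction l) auto
  show "e b = 1 \<and> count_list v b = 2 \<and> b \<notin> set (concat us) \<and> \<iota> b \<notin> set (concat us) \<or>
      e b = - 1 \<and> count_list v b = 1 \<and> (b \<in> set (concat us) \<longleftrightarrow> \<iota> b \<in> set (concat us))"
  proof (cases "\<exists>u\<in>set vs. count_list u b = 2")
    case True
    \<comment> \<open>A block with two occurrences in \<open>us\<close> or \<open>ws\<close> would
      leave none for \<open>v\<close>, which contains \<open>b\<close>.\<close>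
    then obtain u where "u \<in> set us \<or> u = v \<or> u \<in> set ws" "count_list u b = 2"
      by (auto simp: vs)
    then have "count_list v b = 2" using le[of u us] le[of u ws] c v1 by auto
    moreover from this have "b \<notin> set (concat us)"
      using c count_list_0_iff[of "concat us" b] by linarith
    ultimately show ?thesis using True us by (auto simp: e_def phrase_eps_def)
  next
    case False
    then have "count_list v b \<noteq> 2" by (auto simp: vs)
    then have "count_list v b = 1" using c v1 by linarith
    then show ?thesis using False us by (auto simp: e_def phrase_eps_def)
  qed
qed

text \<open>Letters outside \<open>B\<close> keep their linking values. On \<open>B\<close> the
  summand changes sign under \<open>\<iota>\<close>, so reindexing along \<open>\<iota>\<close>
  shows that the sum over \<open>B\<close> is its own negative; this covers fixed points of
  \<open>\<iota>\<close> as well.\<close>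

lemma linking_count_surgery:
  assumes "surgery \<tau> u u'" "is_nanoword u" and \<phi>: "\<And>a. \<phi> (\<tau> a) = - \<phi> a"
  shows "linking_count \<phi> k u = linking_count \<phi> k u'"
  using assms(1)
proof cases
  case (1 B p vs A xs y)
  obtain \<iota> where \<iota>: "bij_betw \<iota> B B" "\<And>v. v \<in> set vs \<Longrightarrow> map \<iota> v = rev v"
    "\<And>b. b \<in> B \<Longrightarrow> p (\<iota> b) = (\<tau> ^^ phrase_eps (B, p, vs) b) (p b)"
    using \<open>symmetric_phrase \<tau> (B, p, vs)\<close> by (auto simp: symmetric_phrase_def)
  define e :: "nat \<Rightarrow> int" where "e = (\<lambda>b. if phrase_eps (B, p, vs) b = 0 then 1 else - 1)"
  have inj: "inj_on \<iota> B" "\<iota> ` B \<subseteq> B" using \<iota>(1) by (auto simp: bij_betw_def)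
  have p: "(\<phi> \<circ> p) (\<iota> b) = e b * (\<phi> \<circ> p) b" if "b \<in> B" for b
    using \<iota>(3)[OF that] by (auto simp: e_def \<phi> phrase_eps_def)
  have e: "e b * e b = 1" for b by (simp add: e_def)
  let ?W = "signed {} (concat (map2 (@) xs vs) @ y)"
  have A: "finite A" using assms(2) nanoword_finite 1(1) by blast
  have B: "set (concat xs) \<inter> B = {}" "set (concat vs) \<subseteq> B" "set y \<inter> B = {}"
    using 1 by (auto simp: is_nanophrase_def)
  have R: "rev (signed ({} \<union> set (concat us)) v) =
      map (\<lambda>(b, t). (\<iota> b, - e b * t)) (signed ({} \<union> set (concat us)) v)"
    if "vs = us @ v # ws" for us v ws
    using symmetric_phrase_rev_signed[OF \<open>is_nanophrase (B, p, vs)\<close> inj(1) \<iota>(2) that]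
    unfolding e_def by simp
  note factor = linking_symmetric_factor[where B = B and s = "{}" and t = "{}" and \<iota> = \<iota>
      and f = "\<phi> \<circ> p" and e = e and xs = xs and vs = vs and y = y,
      OF \<open>length xs = length vs\<close> B(1,2) refl inj p e R B(3)]
  have out: "linking (\<phi> \<circ> p) a 0 ?W = linking (\<phi> \<circ> p) a 0 (signed {} (concat xs @ y))"
    if "a \<notin> B" for a
    using that by (intro factor(1)) simp_all
  have inn: "linking (\<phi> \<circ> p) (\<iota> b) 0 ?W = - e b * linking (\<phi> \<circ> p) b 0 ?W"
    if "b \<in> B" for b
    using that by (intro factor(2)) simp_all
  let ?g = "\<lambda>a. \<phi> (p a) * odd_indicator k (linking (\<phi> \<circ> p) a 0 ?W)"
  have "?g (\<iota> b) = - ?g b" if "b \<in> B" for b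
    using p[OF that] inn[OF that] odd_indicator_twist[OF e] by (simp only: comp_apply)
  then have "(\<Sum>b\<in>B. ?g (\<iota> b)) = - (\<Sum>b\<in>B. ?g b)"
    by (simp add: sum_negf)
  then have "(\<Sum>b\<in>B. ?g b) = 0"
    using sum.reindex_bij_betw[OF \<iota>(1), of ?g] by simp
  then have "(\<Sum>a\<in>A. ?g a) = (\<Sum>a\<in>A - B. ?g a)"
    using sum.subset_diff[OF \<open>B \<subseteq> A\<close> A, of ?g] by simp
  then show ?thesis
    using out by (simp add: 1(1,2) linking_count_def)
qed

section \<open>The first two moves as surgeries, and cobordism invariance\<close>

text \<open>The factor is the single block \<open>[a, a]\<close> with the identity as its
  symmetry.\<close>

lemma homotopy_move1_surgery:
  assumes "is_nanoword (A, p, x @ [a, a] @ y)"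
  shows "surgery \<tau> (A, p, x @ [a, a] @ y) (A - {a}, p, x @ y)"
proof -
  have A: "set (x @ [a, a] @ y) = A" using assms by (rule nanoword_set)
  then have "count_list (x @ [a, a] @ y) a = 2" using assms by (auto simp: is_nanoword_def)
  then have n: "a \<notin> set x" "a \<notin> set y" by (auto simp: count_list_0_iff[symmetric])
  have "surgery \<tau> (A, p, concat (map2 (@) [x] [[a, a]]) @ y) (A - {a}, p, concat [x] @ y)"
  proof (rule surgery.intros)
    show "symmetric_phrase \<tau> ({a}, p, [[a, a]])"
      unfolding symmetric_phrase_def prod.case
      by (intro exI[of _ id]) (auto simp: phrase_eps_def)
  qed (use A n in \<open>auto simp: is_nanophrase_def even_phrase_def\<close>)
  then show ?thesis by simp
qed

text \<open>The factor has the blocks \<open>[a, b]\<close> and \<open>[b, a]\<close>, and the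
  symmetry exchanges the letters. Each letter lies in both blocks, so \<open>phrase_eps\<close> is
  \<open>1\<close> and the types must be exchanged by \<tau>.\<close>

lemma homotopy_move2_surgery:
  assumes "is_nanoword (A, p, x @ [a, b] @ y @ [b, a] @ z)" "p b = \<tau> (p a)" "\<tau> \<circ> \<tau> = id"
  shows "surgery \<tau> (A, p, x @ [a, b] @ y @ [b, a] @ z) (A - {a, b}, p, x @ y @ z)"
proof -
  let ?w = "x @ [a, b] @ y @ [b, a] @ z"
  have A: "set ?w = A" using assms(1) by (rule nanoword_set)
  have "count_list ?w d = 2" if "d \<in> {a, b}" for d
  proof -
    have "d \<in> A" using that unfolding A[symmetric] by auto
    then show ?thesis using assms(1) by (simp only: is_nanoword_def prod.case)
  qed
  from this[of a] this[of b] have n: "a \<noteq> b"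
    "a \<notin> set x" "a \<notin> set y" "a \<notin> set z" "b \<notin> set x" "b \<notin> set y" "b \<notin> set z"
    by (auto simp: count_list_0_iff[symmetric] split: if_splits)
  have pa: "p a = \<tau> (p b)" using assms(2,3) by (metis comp_apply id_apply)
  let ?\<iota> = "\<lambda>n. if n = a then b else a"
  have "surgery \<tau> (A, p, concat (map2 (@) [x, y] [[a, b], [b, a]]) @ z)
      (A - {a, b}, p, concat [x, y] @ z)"
  proof (rule surgery.intros)
    show "symmetric_phrase \<tau> ({a, b}, p, [[a, b], [b, a]])"
      unfolding symmetric_phrase_def prod.case
      by (intro exI[of _ ?\<iota>])
        (use n pa assms(2) in \<open>auto simp: phrase_eps_def bij_betw_def inj_on_def\<close>)
  qed (use A n in \<open>auto simp: is_nanophrase_def even_phrase_def\<close>)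
  then show ?thesis by simp
qed

lemma linking_count_cobordism_step:
  assumes "cobordism_step \<tau> u v" and \<tau>: "\<tau> \<circ> \<tau> = id" and \<phi>: "\<And>a. \<phi> (\<tau> a) = - \<phi> a"
  shows "linking_count \<phi> k u = linking_count \<phi> k v"
proof -
  have u: "is_nanoword u" using assms(1) by (simp add: cobordism_step_def)
  consider "isomorphic u v" | "homotopy_move \<tau> u v" | "surgery \<tau> u v"
    using assms(1) by (auto simp: cobordism_step_def)
  then show ?thesis
  proof cases
    case 2
    then show ?thesis
    proof cases
      case (move1 A p x a y)
      then show ?thesis
        using linking_count_surgery[OF _ u, of \<tau>] homotopy_move1_surgery u \<phi> by metis
    next
      case (move2 p b a A x y z)
      then show ?thesis
        using linking_count_surgery[OF _ u, of \<tau>] homotopy_move2_surgery[OF _ _ \<tau>] u \<phi> by metis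
    next
      case (move3 a b c p A x y z t)
      then show ?thesis using linking_count_move3 u by metis
    qed
  qed (use linking_count_isomorphic linking_count_surgery u \<phi> in blast)+
qed

lemma linking_count_cobordism_rel:
  assumes "(u, v) \<in> cobordism_rel \<tau>" and "\<tau> \<circ> \<tau> = id" "\<And>a. \<phi> (\<tau> a) = - \<phi> a"
  shows "linking_count \<phi> k u = linking_count \<phi> k v"
proof -
  have "equivclp (cobordism_step \<tau>) u v" using assms(1) by (simp add: cobordism_rel_def)
  then show ?thesis
  proof (induction rule: equivclp_induct)
    case (step v w)
    then show ?case
      using linking_count_cobordism_step[of \<tau> v w \<phi> k, OF _ assms(2,3)]
        linking_count_cobordism_step[of \<tau> w v \<phi> k, OF _ assms(2,3)] by auto
  qed simp
qed

section \<open>Vanishing for large indices, and the nested words\<close>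

text \<open>Take \<open>k\<close> above the absolute values of the finitely many linking
  values.\<close>

lemma eventually_linking_count_0:
  assumes "is_nanoword u"
  shows "\<forall>\<^sub>F k in at_top. linking_count \<phi> k u = 0"
proof -
  obtain A p w where u: "u = (A, p, w)" by (metis prod_cases3)
  have "\<forall>\<^sub>F k in at_top. \<forall>a\<in>A. \<bar>linking (\<phi> \<circ> p) a 0 (signed {} w)\<bar> < k"
    using nanoword_finite assms u
    by (intro eventually_ball_finite ballI eventually_gt_at_top) blast
  then show ?thesis
  proof eventually_elim
    case (elim k)
    have "odd_indicator k (linking (\<phi> \<circ> p) a 0 (signed {} w)) = 0" if "a \<in> A" for a
      using bspec[OF elim that] by (auto simp: odd_indicator_def)
    then show ?case by (simp add: linking_count_def u)
  qed
qed

text \<open>The letter \<open>0\<close> is the \<open>a\<close> of the word given at the beginning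
  and \<open>i > 0\<close> is its \<open>b\<^sub>i\<close>; all letters have the same type.\<close>

definition nested_word :: "'a \<Rightarrow> nat \<Rightarrow> 'a nanoword" where
  "nested_word a n = ({..n}, \<lambda>_. a, 0 # [1..<Suc n] @ 0 # rev [1..<Suc n])"

lemma count_list_distinct: "distinct w \<Longrightarrow> count_list w a = of_bool (a \<in> set w)"
  by (induction w) auto

lemma nested_word_nanoword: "is_nanoword (nested_word a n)"
  by (auto simp: is_nanoword_def nested_word_def count_list_distinct simp del: upt_Suc)

lemma signed_fresh: "distinct w \<Longrightarrow> set w \<inter> s = {} \<Longrightarrow> signed s w = map (\<lambda>a. (a, 1)) w"
  by (induction w arbitrary: s) auto

lemma signed_seen: "set w \<subseteq> s \<Longrightarrow> signed s w = map (\<lambda>a. (a, - 1)) w"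
  by (induction w arbitrary: s) (auto simp: subset_insertI2)

text \<open>Between the two occurrences of \<open>i > 0\<close>, the letters above \<open>i\<close>
  cancel and the second \<open>0\<close> leaves weight \<open>- 1\<close>, hence the value
  \<open>2\<close>. The condition \<open>n > 1\<close> separates it from \<open>2 * n\<close>, so
  that only the letter \<open>0\<close>, with value \<open>- 2 * n\<close>, counts.\<close>

lemma linking_count_nested_word:
  assumes "\<phi> a = 1" "n > 1"
  shows "linking_count \<phi> (2 * int n) (nested_word a n) = - 1"
proof -
  let ?f = "\<phi> \<circ> (\<lambda>_. a)" and ?v = "[1..<Suc n]"
  let ?W = "signed {} (0 # ?v @ 0 # rev ?v)"
  let ?P = "map (\<lambda>a. (a, 1 :: int))" and ?M = "map (\<lambda>a. (a, - 1 :: int))"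
  have W: "?W = (0, 1) # ?P ?v @ (0, - 1) # ?M (rev ?v)"
    by (simp add: signed_fresh signed_seen subset_insertI del: upt_Suc)
  have T: "weight_sum ?f (?P l) = int (length l)" "weight_sum ?f (?M l) = - int (length l)" for l
    by (induction l) (simp_all add: assms(1))
  have L: "linking ?f b c (?P l) = 0" "linking ?f b c (?M l) = 0" if "b \<notin> set l" for b c l
    using that by (auto intro!: linking_eq_0)
  have L0: "linking ?f 0 0 ?W = - 2 * int n"
    unfolding W using assms(1) by (simp add: T L del: upt_Suc)
  have Li: "linking ?f i 0 ?W = 2" if "i \<in> {1..n}" for i
  proof -
    have v: "?v = [1..<i] @ i # [Suc i..<Suc n]"
      using that upt_add_eq_append[of 1 i "Suc n - i"] by (simp add: upt_conv_Cons del: upt_Suc)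
    show ?thesis
      unfolding W unfolding v using that assms(1) by (simp add: T L rev_map of_nat_diff del: upt_Suc)
  qed
  have "linking_count \<phi> (2 * int n) (nested_word a n) =
      (\<Sum>i\<in>insert 0 {1..n}. odd_indicator (2 * int n) (linking ?f i 0 ?W))"
    unfolding linking_count_def nested_word_def prod.case assms(1) mult_1
    by (rule arg_cong[where f = "sum _"]) auto
  also have "\<dots> = odd_indicator (2 * int n) (linking ?f 0 0 ?W) +
      (\<Sum>i\<in>{1..n}. odd_indicator (2 * int n) (linking ?f i 0 ?W))"
    by (rule sum.insert) auto
  also have "(\<Sum>i\<in>{1..n}. odd_indicator (2 * int n) (linking ?f i 0 ?W)) = 0"
  proof (intro sum.neutral ballI)
    fix i assume "i \<in> {1..n}"
    from Li[OF this] show "odd_indicator (2 * int n) (linking ?f i 0 ?W) = 0"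
      using assms(2) by (simp only:) (simp add: odd_indicator_def)
  qed
  finally show ?thesis using assms(2) unfolding L0 by (simp add: odd_indicator_def)
qed

section \<open>Infinite generation\<close>

theorem theorem8p1p1:
  fixes \<tau> :: "'a \<Rightarrow> 'a"
  assumes "\<tau> \<circ> \<tau> = id" and "\<tau> \<noteq> id"
  shows "\<not> (\<exists>S. finite S \<and> S \<subseteq> carrier (cobordism_group \<tau>) \<and>
               generate (cobordism_group \<tau>) S = carrier (cobordism_group \<tau>))"
proof
  let ?G = "cobordism_group \<tau>"
  let ?c = "\<lambda>u. cobordism_rel \<tau> `` {u}"
  assume "\<exists>S. finite S \<and> S \<subseteq> carrier ?G \<and> generate ?G S = carrier ?G"
  then obtain S where S: "finite S" "S \<subseteq> carrier ?G" "generate ?G S = carrier ?G" by blast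
  interpret G: group ?G by (rule group_cobordism_group)
  have \<tau>: "\<tau> (\<tau> a) = a" for a using assms(1) by (metis comp_apply id_apply)
  obtain a where a: "\<tau> a \<noteq> a" using assms(2) by (auto simp: fun_eq_iff)
  \<comment> \<open>The indicator of \<open>a\<close>, made odd under \<tau>; it is nonzero because
    \<open>a\<close> is not fixed.\<close>
  define \<phi> :: "'a \<Rightarrow> int" where "\<phi> = (\<lambda>b. of_bool (b = a) - of_bool (b = \<tau> a))"
  have \<phi>: "\<phi> (\<tau> b) = - \<phi> b" for b
  proof -
    have "\<tau> b = a \<longleftrightarrow> b = \<tau> a" "\<tau> b = \<tau> a \<longleftrightarrow> b = a" by (metis \<tau>)+
    then show ?thesis by (simp add: \<phi>_def)
  qed
  have "\<phi> a = 1" using a by (simp add: \<phi>_def)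
  note eqv = equiv_cobordism_rel[of \<tau>]
  have carrier: "X \<in> carrier ?G \<longleftrightarrow> (\<exists>u. is_nanoword u \<and> X = ?c u)" for X
    by (auto simp: cobordism_group_def quotient_def)
  have c_carrier: "?c u \<in> carrier ?G" if "is_nanoword u" for u
    unfolding carrier by (rule exI[of _ u]) (simp add: that)
  have "\<forall>X\<in>carrier ?G. \<exists>u. is_nanoword u \<and> X = ?c u"
    using carrier by (rule iffD1[THEN ballI])
  then obtain rep where rep: "\<forall>X\<in>carrier ?G. is_nanoword (rep X) \<and> X = ?c (rep X)"
    by (rule bchoice[THEN exE])
  \<comment> \<open>The invariant on classes, by chosen representatives; cobordism invariance makes
    the choice irrelevant.\<close>
  define \<Phi> where "\<Phi> = (\<lambda>k X. linking_count \<phi> k (rep X))"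
  have \<Phi>: "\<Phi> k (?c u) = linking_count \<phi> k u" if "is_nanoword u" for k u
  proof -
    from bspec[OF rep c_carrier[OF that]] have r: "is_nanoword (rep (?c u))" "?c u = ?c (rep (?c u))"
      by (rule conjunct1, rule conjunct2)
    have "(u, rep (?c u)) \<in> cobordism_rel \<tau>"
      by (rule eq_equiv_class[OF r(2) eqv]) (use r(1) in blast)
    from linking_count_cobordism_rel[of _ _ \<tau> \<phi>, OF this assms(1) \<phi>]
    show ?thesis unfolding \<Phi>_def by (rule sym)
  qed
  have mult: "\<Phi> k (X \<otimes>\<^bsub>?G\<^esub> Y) = \<Phi> k X + \<Phi> k Y"
    if "X \<in> carrier ?G" "Y \<in> carrier ?G" for k X Y
    using that unfolding carrier
    by (auto simp: cobordism_group_mult \<Phi> nanoword_prod_nanoword linking_count_prod)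
  \<comment> \<open>The kernel of the homomorphism \<open>\<Phi> k\<close> is a subgroup; once it
    contains the generators, it is the whole group.\<close>
  have zero: "\<Phi> k X = 0" if k: "\<forall>Y\<in>S. \<Phi> k Y = 0" and X: "X \<in> carrier ?G" for k X
  proof -
    have one: "\<Phi> k \<one>\<^bsub>?G\<^esub> = 0" using mult[of "\<one>\<^bsub>?G\<^esub>" "\<one>\<^bsub>?G\<^esub>" k] by simp
    have "subgroup {X \<in> carrier ?G. \<Phi> k X = 0} ?G"
    proof (rule G.subgroupI)
      show "{X \<in> carrier ?G. \<Phi> k X = 0} \<subseteq> carrier ?G" by blast
      show "{X \<in> carrier ?G. \<Phi> k X = 0} \<noteq> {}" using one G.one_closed by blast
    next
      fix Y Z assume "Y \<in> {X \<in> carrier ?G. \<Phi> k X = 0}" "Z \<in> {X \<in> carrier ?G. \<Phi> k X = 0}"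
      then show "Y \<otimes>\<^bsub>?G\<^esub> Z \<in> {X \<in> carrier ?G. \<Phi> k X = 0}"
        using mult[of Y Z k] by simp
    next
      fix Y assume "Y \<in> {X \<in> carrier ?G. \<Phi> k X = 0}"
      then show "inv\<^bsub>?G\<^esub> Y \<in> {X \<in> carrier ?G. \<Phi> k X = 0}"
        using mult[of "inv\<^bsub>?G\<^esub> Y" Y k] one by simp
    qed
    moreover have "S \<subseteq> {X \<in> carrier ?G. \<Phi> k X = 0}" using S(2) k by blast
    ultimately have "generate ?G S \<subseteq> {X \<in> carrier ?G. \<Phi> k X = 0}"
      by (intro G.generate_subgroup_incl)
    then show ?thesis using X S(3) by blast
  qed
  have "\<forall>\<^sub>F k in at_top. \<forall>X\<in>S. \<Phi> k X = 0"
    unfolding \<Phi>_def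
  proof (intro eventually_ball_finite ballI eventually_linking_count_0 S(1))
    fix X assume "X \<in> S"
    then show "is_nanoword (rep X)" using bspec[OF rep, of X] S(2) by blast
  qed
  then obtain K where K: "\<And>k. k \<ge> K \<Longrightarrow> \<forall>X\<in>S. \<Phi> k X = 0"
    unfolding eventually_at_top_linorder by blast
  \<comment> \<open>This ensures both \<open>2 * n \<ge> K\<close> and \<open>n > 1\<close>.\<close>
  define n where "n = nat K + 2"
  have "\<Phi> (2 * int n) (?c (nested_word a n)) = 0"
  proof (rule zero)
    show "\<forall>X\<in>S. \<Phi> (2 * int n) X = 0" by (rule K) (simp add: n_def)
    show "?c (nested_word a n) \<in> carrier ?G" by (rule c_carrier[OF nested_word_nanoword])
  qed
  moreover have "\<Phi> (2 * int n) (?c (nested_word a n)) = - 1"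
    using \<Phi>[OF nested_word_nanoword] linking_count_nested_word[of \<phi> a n, OF \<open>\<phi> a = 1\<close>]
    by (simp add: n_def)
  ultimately show False by simp
qed

end
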